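(* Let $k$ be a field with $\operatorname{char}k\neq 2$ and $M\supseteq k$ an infinite field. For $\mathbf a=(a,b),\ \mathbf a'=(a',b')\in M^2$ with $\mathbf a\neq\mathbf a'$ and $D_{\mathbf a}D_{\mathbf a'}\neq 0$, the $M$-algebras $M[X]/(X^4+aX^2+bX+b)$ and $M[X]/(X^4+a'X^2+b'X+b')$ are $M$-isomorphic if and only if either (i) there exists $p\in M$ such that $a'=\dfrac{P_{\mathbf a,p}Q_{\mathbf a,p}^2}{R_{\mathbf a,p}^2}$, $b'=\dfrac{Q_{\mathbf a,p}^4}{R_{\mathbf a,p}^3}$, or (ii) there exist $u,v\in M$ such that $a'=\dfrac{U_{\mathbf a,u,v}V_{\mathbf a,u,v}^2}{W_{\mathbf a,u,v}^2}$, $b'=\dfrac{V_{\mathbf a,u,v}^4}{W_{\mathbf a,u,v}^3}$, where $P_{\mathbf a,p},Q_{\mathbf a,p},R_{\mathbf a,p},U_{\mathbf a,u,v},V_{\mathbf a,u,v},W_{\mathbf a,u,v}$ are obtained from the polynomials below by substituting $(s,t)=(a,b)$: $P=-2(s^2-4t)+6tp+sp^2$, $Q=-8t^2-8stp-2(s^2-4t)p^2+tp^3$, $R=s^4-8s^2t+16t^2+8st^2+2t(s^2-4t)p+s(s^2-4t)p^2-stp^3+tp^4$, $U=16s^3-48st-6t^2-8s^2u+16tu+su^2-28stv+6tuv-2s^2v^2+8tv^2$, $V=96s^3t-96st^2+8t^3-64s^2tu+16t^2u+14stu^2-tu^3+32s^4v-160s^2tv+128t^2v-40st^2v-16s^3uv+64stuv+12t^2uv+2s^2u^2v-8tu^2v-32s^2tv^2+64t^2v^2+8stuv^2+8t^2v^3$,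 $W=144s^3t^2+256t^3+144st^3-3t^4-128st^2u-120s^2t^2u-32t^3u+16s^2tu^2+32t^2u^2+33st^2u^2-8stu^3-3t^2u^3+tu^4+96s^4tv-288s^2t^2v+256t^3v+68st^3v-64s^3tuv+80st^2uv-18t^3uv+14s^2tu^2v-stu^3v+16s^5v^2-112s^3tv^2+192st^2v^2+2s^2t^2v^2+120t^3v^2-8s^4uv^2+48s^2tuv^2-64t^2uv^2+s^3u^2v^2-4stu^2v^2-4s^3tv^3+16st^2v^3+24t^3v^3+2s^2tuv^3-8t^2uv^3+s^4v^4-8s^2tv^4+16t^2v^4+8st^2v^4$.
   Context: For $\mathbf a=(a,b)\in M^2$, $D_{\mathbf a}=b(16a^4-128a^2b-4a^3b+256b^2+144ab^2-27b^3)$ is the discriminant of $X^4+aX^2+bX+b$. *)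

theory Defs
  imports "HOL-Algebra.Algebraic_Closure_Type"
begin

text \<open>
  The field \<open>M\<close> is the universe of a type \<open>'m::field\<close>, with polynomials from \<open>'m poly\<close>;
  subfields, quotient rings and ring isomorphisms are those of HOL-Algebra, applied to the ring
  record \<^const>\<open>ring_of_type_algebra\<close> of the type.
\<close>

text \<open>Record version of \<^const>\<open>semiring_char\<close>, needed for a subfield given as a set.\<close>

definition characteristic :: "('a, 'b) ring_scheme \<Rightarrow> nat" where
  "characteristic R = Gcd {n::nat. [n] \<cdot>\<^bsub>R\<^esub> \<one>\<^bsub>R\<^esub> = \<zero>\<^bsub>R\<^esub>}"

definition quartic :: "'m::field \<Rightarrow> 'm \<Rightarrow> 'm poly" where
  "quartic a b = [:b, b, a, 0, 1:]"

definition principal :: "'m::field poly \<Rightarrow> 'm poly set" where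
  "principal f = PIdl\<^bsub>ring_of_type_algebra\<^esub> f"

definition quotient_algebra :: "'m::field poly \<Rightarrow> 'm poly set ring" where
  "quotient_algebra f = ring_of_type_algebra Quot principal f"

text \<open>The structure map \<open>M \<rightarrow> M[X]/(f)\<close>.\<close>

definition scalar :: "'m::field poly \<Rightarrow> 'm \<Rightarrow> 'm poly set" where
  "scalar f c = principal f +>\<^bsub>ring_of_type_algebra\<^esub> [:c:]"

text \<open>An isomorphism of \<open>M\<close>-algebras is a ring isomorphism commuting with the structure maps.\<close>

definition isomorphic_algebras :: "'m::field poly \<Rightarrow> 'm poly \<Rightarrow> bool" where
  "isomorphic_algebras f g \<longleftrightarrow>
     (\<exists>h \<in> ring_iso (quotient_algebra f) (quotient_algebra g). \<forall>c. h (scalar f c) = scalar g c)"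

text \<open>The discriminant of \<^term>\<open>quartic a b\<close>.\<close>

definition D :: "'a::comm_ring_1 \<Rightarrow> 'a \<Rightarrow> 'a" where
  "D a b =
    b * (16 * a^4 - 128 * a^2 * b - 4 * a^3 * b + 256 * b^2 + 144 * a * b^2 - 27 * b^3)"

text \<open>
  In \<open>M[x] = M[X]/(X^4 + sX^2 + tX + t)\<close>, the characteristic polynomial of \<open>2x^2 + px + s\<close> is
  \<open>X^4 + PX^2 + QX + R\<close>, and that of \<open>4x^3 + 2vx^2 + ux + 3t + sv\<close> is \<open>X^4 + UX^2 - VX + W\<close>.
\<close>

definition P :: "'a::comm_ring_1 \<Rightarrow> 'a \<Rightarrow> 'a \<Rightarrow> 'a" where
  "P s t p =
    -2 * (s^2 - 4 * t) + 6 * t * p + s * p^2"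

definition Q :: "'a::comm_ring_1 \<Rightarrow> 'a \<Rightarrow> 'a \<Rightarrow> 'a" where
  "Q s t p =
    -8 * t^2 - 8 * s * t * p - 2 * (s^2 - 4 * t) * p^2 + t * p^3"

definition R :: "'a::comm_ring_1 \<Rightarrow> 'a \<Rightarrow> 'a \<Rightarrow> 'a" where
  "R s t p =
    s^4 - 8 * s^2 * t + 16 * t^2 + 8 * s * t^2 + 2 * t * (s^2 - 4 * t) * p
      + s * (s^2 - 4 * t) * p^2 - s * t * p^3 + t * p^4"

definition U :: "'a::comm_ring_1 \<Rightarrow> 'a \<Rightarrow> 'a \<Rightarrow> 'a \<Rightarrow> 'a" where
  "U s t u v =
    16 * s^3 - 48 * s * t - 6 * t^2 - 8 * s^2 * u + 16 * t * u + s * u^2 - 28 * s * t * v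
      + 6 * t * u * v - 2 * s^2 * v^2 + 8 * t * v^2"

definition V :: "'a::comm_ring_1 \<Rightarrow> 'a \<Rightarrow> 'a \<Rightarrow> 'a \<Rightarrow> 'a" where
  "V s t u v =
    96 * s^3 * t - 96 * s * t^2 + 8 * t^3 - 64 * s^2 * t * u + 16 * t^2 * u
      + 14 * s * t * u^2 - t * u^3 + 32 * s^4 * v - 160 * s^2 * t * v + 128 * t^2 * v
      - 40 * s * t^2 * v - 16 * s^3 * u * v + 64 * s * t * u * v + 12 * t^2 * u * v
      + 2 * s^2 * u^2 * v - 8 * t * u^2 * v - 32 * s^2 * t * v^2 + 64 * t^2 * v^2
      + 8 * s * t * u * v^2 + 8 * t^2 * v^3"

definition W :: "'a::comm_ring_1 \<Rightarrow> 'a \<Rightarrow> 'a \<Rightarrow> 'a \<Rightarrow> 'a" where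
  "W s t u v =
    144 * s^3 * t^2 + 256 * t^3 + 144 * s * t^3 - 3 * t^4 - 128 * s * t^2 * u
      - 120 * s^2 * t^2 * u - 32 * t^3 * u + 16 * s^2 * t * u^2 + 32 * t^2 * u^2
      + 33 * s * t^2 * u^2 - 8 * s * t * u^3 - 3 * t^2 * u^3 + t * u^4 + 96 * s^4 * t * v
      - 288 * s^2 * t^2 * v + 256 * t^3 * v + 68 * s * t^3 * v - 64 * s^3 * t * u * v
      + 80 * s * t^2 * u * v - 18 * t^3 * u * v + 14 * s^2 * t * u^2 * v - s * t * u^3 * v
      + 16 * s^5 * v^2 - 112 * s^3 * t * v^2 + 192 * s * t^2 * v^2 + 2 * s^2 * t^2 * v^2
      + 120 * t^3 * v^2 - 8 * s^4 * u * v^2 + 48 * s^2 * t * u * v^2 - 64 * t^2 * u * v^2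
      + s^3 * u^2 * v^2 - 4 * s * t * u^2 * v^2 - 4 * s^3 * t * v^3 + 16 * s * t^2 * v^3
      + 24 * t^3 * v^3 + 2 * s^2 * t * u * v^3 - 8 * t^2 * u * v^3 + s^4 * v^4
      - 8 * s^2 * t * v^4 + 16 * t^2 * v^4 + 8 * s * t^2 * v^4"

end

theory Submission
  imports Defs
begin

text \<open>
  Over an algebraic closure the roots of the two quartics are simple, so an isomorphism of the
  quotient algebras is the same thing as a polynomial \<open>y\<close> over \<open>M\<close> mapping the roots of the
  first quartic bijectively onto those of the second. Modulo the first quartic,
  \<open>y = c + \<mu>z\<close> with \<open>z\<close> among \<open>x\<close>, \<open>2x^2 + px + s\<close> and \<open>4x^3 + 2vx^2 + ux + 3t + sv\<close>, all of
  trace zero; a missing cubic term forces \<open>c = 0\<close>, and equality of the two lowest coefficients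
  determines \<open>\<mu>\<close> from the characteristic polynomial of \<open>z\<close>. The case \<open>z = x\<close> gives
  \<open>\<mu> = 1\<close>, i.e. the same quartic.
\<close>

section \<open>Characteristic polynomials as resultants\<close>

text \<open>The parameters make \<open>2x^2 + px + s - \<tau>\<close> equal to
  \<open>2(x - \<alpha>)(x - \<beta>)\<close>. Its product over the four roots of \<open>f\<close>
  is the characteristic polynomial at \<open>\<tau>\<close>; regrouping the factors by
  \<open>\<alpha>\<close> and \<open>\<beta>\<close> gives
  \<open>2^4 f(\<alpha>) f(\<beta>)\<close>.\<close>

lemma quadratic_resultant:
  fixes s t \<alpha> \<beta> :: "'a::idom"
  defines "f \<equiv> \<lambda>x. x^4 + s * x^2 + t * x + t"
  defines "p \<equiv> -2 * (\<alpha> + \<beta>)" and "\<tau> \<equiv> s - 2 * (\<alpha> * \<beta>)"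
  shows "\<tau>^4 + P s t p * \<tau>^2 + Q s t p * \<tau> + R s t p = 16 * (f \<alpha> * f \<beta>)"
  unfolding f_def p_def \<tau>_def P_def Q_def R_def by Groebner_Basis.algebra

text \<open>The resultant of a quadratic with the monic cubic whose roots are
  \<open>\<alpha>\<close>, \<open>\<beta>\<close>, \<open>\<gamma>\<close>, expanded in elementary
  symmetric functions. The larger identity below can then be checked without the individual
  roots.\<close>

lemma norm_of_quadratic:
  fixes \<alpha> \<beta> \<gamma> :: "'a::idom"
  assumes "e1 = \<alpha> + \<beta> + \<gamma>" "e2 = \<alpha> * \<beta> + \<beta> * \<gamma> + \<gamma> * \<alpha>" "e3 = \<alpha> * \<beta> * \<gamma>"
  shows "(r0 + r1 * \<alpha> + r2 * \<alpha>^2) * (r0 + r1 * \<beta> + r2 * \<beta>^2) * (r0 + r1 * \<gamma> + r2 * \<gamma>^2) =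
    r0^3 + r0^2 * r1 * e1 + r0^2 * r2 * (e1^2 - 2 * e2) + r0 * r1^2 * e2
    + r0 * r1 * r2 * (e1 * e2 - 3 * e3) + r0 * r2^2 * (e2^2 - 2 * e1 * e3)
    + r1^3 * e3 + r1^2 * r2 * e1 * e3 + r1 * r2^2 * e2 * e3 + r2^3 * e3^2"
  unfolding assms by Groebner_Basis.algebra

text \<open>
  Here \<open>r0 + r1 x + r2 x^2\<close> is the remainder of \<open>x^4 + sx^2 + tx + t\<close> modulo the cubic
  \<open>x^3 - e1 x^2 + e2 x - e3\<close>, so by the previous lemma the right-hand side is \<open>4^4\<close> times the
  product of the values of the quartic at the roots of the cubic.
\<close>

lemma cubic_charpoly:
  fixes s t e1 e2 e3 :: "'a::idom"
  defines "u \<equiv> 4 * e2" and "v \<equiv> -2 * e1"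
  defines "\<tau> \<equiv> 3 * t + s * v + 4 * e3"
  defines "r0 \<equiv> e1 * e3 + t" and "r1 \<equiv> e3 - e1 * e2 + t" and "r2 \<equiv> e1^2 - e2 + s"
  shows "\<tau>^4 + U s t u v * \<tau>^2 - V s t u v * \<tau> + W s t u v =
    256 * (r0^3 + r0^2 * r1 * e1 + r0^2 * r2 * (e1^2 - 2 * e2) + r0 * r1^2 * e2
    + r0 * r1 * r2 * (e1 * e2 - 3 * e3) + r0 * r2^2 * (e2^2 - 2 * e1 * e3)
    + r1^3 * e3 + r1^2 * r2 * e1 * e3 + r1 * r2^2 * e2 * e3 + r2^3 * e3^2)"
  unfolding U_def V_def W_def u_def v_def \<tau>_def r0_def r1_def r2_def by Groebner_Basis.algebra

section \<open>Roots in the algebraic closure\<close>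

text \<open>Eliminating \<open>t\<close> by the derivative turns the quartic into \<open>-x\<close>
  times a cubic. The root \<open>x = 0\<close> forces \<open>t = 0\<close>, and \<open>t\<close> is
  a factor of \<open>D\<close>; vanishing of the cubic forces \<open>D\<close> to vanish as
  well.\<close>

lemma D_zero_if_double_root:
  fixes x s t :: "'a::idom"
  assumes f: "x^4 + s * x^2 + t * x + t = 0" and f': "4 * x^3 + 2 * s * x + t = 0"
  shows "D s t = 0"
proof -
  have t: "t = - (4 * x^3 + 2 * s * x)"
    using f' by Groebner_Basis.algebra
  have "x * (3 * x^3 + 4 * x^2 + s * x + 2 * s) = 0"
    using f unfolding t by Groebner_Basis.algebra
  then consider "x = 0" | "3 * x^3 + 4 * x^2 + s * x + 2 * s = 0"
    by auto
  then show ?thesis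
  proof cases
    case 1
    then show ?thesis by (simp add: t D_def)
  next
    case 2
    then show ?thesis unfolding t D_def by Groebner_Basis.algebra
  qed
qed

text \<open>Roots may lie outside \<open>M\<close>, so the argument ranges over the algebraic
  closure while the coefficients stay in \<open>M\<close>.\<close>

definition ev :: "'m::field alg_closure \<Rightarrow> 'm poly \<Rightarrow> 'm alg_closure" where
  "ev x p = poly (map_poly to_ac p) x"

lemma ev_0 [simp]: "ev x 0 = 0"
  by (simp add: ev_def)

lemma ev_pCons [simp]: "ev x (pCons c p) = to_ac c + x * ev x p"
  by (simp add: ev_def map_poly_pCons)

lemma ev_add [simp]: "ev x (p + q) = ev x p + ev x q"
  by (induction p q rule: poly_induct2) (auto simp: algebra_simps)

lemma ev_smult [simp]: "ev x (smult c p) = to_ac c * ev x p"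
  by (induction p) (auto simp: algebra_simps)

lemma ev_diff [simp]: "ev x (p - q) = ev x p - ev x q"
  using ev_add[of x "p - q" q] by simp

lemma ev_mult [simp]: "ev x (p * q) = ev x p * ev x q"
  by (induction p) (auto simp: algebra_simps)

lemma ev_pcompose [simp]: "ev x (pcompose p q) = ev (ev x q) p"
  by (induction p) (auto simp: pcompose_pCons)

text \<open>A field embedding is injective: a nonzero difference has an inverse, and if it were sent
  to 0, so would be 1.\<close>

lemma to_ac_eq_iff [simp]: "to_ac a = to_ac b \<longleftrightarrow> a = b"
proof
  assume "to_ac a = to_ac b"
  then have "to_ac (a - b) = 0" by simp
  then have "to_ac (a - b) * to_ac (inverse (a - b)) = 0" by simp
  then have "to_ac ((a - b) * inverse (a - b)) = 0" by (metis to_ac_mult)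
  then show "a = b" by (cases "a = b") auto
qed auto

lemma to_ac_eq_0_iff [simp]: "to_ac a = 0 \<longleftrightarrow> a = 0"
  using to_ac_eq_iff[of a 0] by (simp del: to_ac_eq_iff)

section \<open>Separability and divisibility tested at roots\<close>

definition aroots :: "'m::field poly \<Rightarrow> 'm alg_closure set" where
  "aroots p = {x. ev x p = 0}"

text \<open>Separability by counting distinct roots in the closure, the form in which it meets the
  degree bounds below.\<close>

definition separable :: "'m::field poly \<Rightarrow> bool" where
  "separable p \<longleftrightarrow> p \<noteq> 0 \<and> card (aroots p) = Polynomial.degree p"

lemma degree_map_to_ac [simp]: "Polynomial.degree (map_poly to_ac p) = Polynomial.degree p"
  by (rule degree_map_poly) auto

lemma map_to_ac_eq_0_iff [simp]: "map_poly to_ac p = 0 \<longleftrightarrow> p = 0"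
  by (subst map_poly_eq_0_iff) auto

lemma finite_aroots: "p \<noteq> 0 \<Longrightarrow> finite (aroots p)"
  unfolding aroots_def ev_def by (rule poly_roots_finite) simp

lemma eq_0_if_many_roots:
  assumes "Polynomial.degree p < card A" "\<And>x. x \<in> A \<Longrightarrow> ev x p = 0"
  shows "p = 0"
proof -
  have "map_poly to_ac p = 0"
    using assms by (intro poly_eqI_degree[of A]) (auto simp: ev_def)
  then show ?thesis by simp
qed

text \<open>The remainder of \<open>q\<close> takes the values of \<open>q\<close> at the roots of
  \<open>p\<close>. If these vanish, it has more roots than its degree allows.\<close>

lemma dvd_iff_vanishes_on_aroots:
  assumes "separable p" "Polynomial.degree p > 0"
  shows "p dvd q \<longleftrightarrow> (\<forall>x\<in>aroots p. ev x q = 0)"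
proof
  assume "p dvd q"
  then show "\<forall>x\<in>aroots p. ev x q = 0" by (auto simp: aroots_def)
next
  assume q: "\<forall>x\<in>aroots p. ev x q = 0"
  have "q mod p = 0"
  proof (rule eq_0_if_many_roots)
    \<comment> \<open>Positive degree of \<open>p\<close> covers the zero remainder, whose degree is
      0 by convention.\<close>
    show "Polynomial.degree (q mod p) < card (aroots p)"
      using assms degree_mod_less[of p q] by (auto simp: separable_def)
    fix x assume x: "x \<in> aroots p"
    have "ev x q = ev x (q div p * p + q mod p)" by (simp only: div_mult_mod_eq)
    also have "\<dots> = ev x (q mod p)" using x by (simp only: ev_add ev_mult) (simp add: aroots_def)
    finally show "ev x (q mod p) = 0" using x q by auto
  qed
  then show "p dvd q" by auto
qed

text \<open>Induction, splitting off a linear factor: \<open>p = (X - x) q\<close> gives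
  \<open>p'(y) = q(y) + (y - x) q'(y)\<close>. At \<open>y = x\<close> this shows that
  \<open>x\<close> is not a root of \<open>q\<close>; at a root of \<open>q\<close> it shows that
  this root is simple for \<open>q\<close> too.\<close>

lemma card_roots_if_no_double_root:
  fixes p :: "'a::alg_closed_field poly"
  assumes "p \<noteq> 0" "\<And>x. poly p x = 0 \<Longrightarrow> poly (pderiv p) x \<noteq> 0"
  shows "card {x. poly p x = 0} = Polynomial.degree p"
  using assms
proof (induction "Polynomial.degree p" arbitrary: p)
  case 0
  then show ?case by (auto elim!: degree_eq_zeroE)
next
  case (Suc n)
  obtain x where x: "poly p x = 0"
    using alg_closed_imp_poly_has_root[of p] Suc.hyps(2) by auto
  then obtain q where p: "p = [:-x, 1:] * q"
    unfolding poly_eq_0_iff_dvd by (elim dvdE)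
  have "q \<noteq> 0" using p Suc.prems by auto
  then have deg: "Polynomial.degree p = Suc (Polynomial.degree q)"
    unfolding p by (subst degree_mult_eq) auto
  have p': "poly (pderiv p) y = poly q y + (y - x) * poly (pderiv q) y" for y
    unfolding p pderiv_mult poly_add poly_mult by (simp add: pderiv_pCons algebra_simps)
  have "card {y. poly q y = 0} = Polynomial.degree q"
  proof (rule Suc.hyps(1))
    show "n = Polynomial.degree q" using Suc.hyps(2) deg by simp
    show "poly (pderiv q) y \<noteq> 0" if "poly q y = 0" for y
      using Suc.prems(2)[of y] that p'[of y] by (auto simp: p)
  qed fact
  moreover have "poly q x \<noteq> 0"
    using Suc.prems(2)[OF x] p'[of x] by simp
  moreover have "{y. poly p y = 0} = insert x {y. poly q y = 0}"
    unfolding p by (auto simp: algebra_simps)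
  ultimately show ?case
    using poly_roots_finite[OF \<open>q \<noteq> 0\<close>] deg by simp
qed

lemma separable_if_D_nonzero:
  assumes "D a b \<noteq> 0"
  shows "separable (quartic a b)"
proof -
  let ?f = "map_poly to_ac (quartic a b)"
  have f: "?f = [:to_ac b, to_ac b, to_ac a, 0, 1:]"
    by (simp add: quartic_def map_poly_pCons)
  have D: "D (to_ac a) (to_ac b) = to_ac (D a b)"
    by (simp add: D_def)
  have "card {x. poly ?f x = 0} = Polynomial.degree ?f"
  proof (rule card_roots_if_no_double_root)
    fix x assume x: "poly ?f x = 0"
    show "poly (pderiv ?f) x \<noteq> 0"
    proof
      assume x': "poly (pderiv ?f) x = 0"
      have "D (to_ac a) (to_ac b) = 0"
      proof (rule D_zero_if_double_root)
        show "x^4 + to_ac a * x^2 + to_ac b * x + to_ac b = 0"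
          using x by (simp add: f algebra_simps power_numeral_reduce)
        show "4 * x^3 + 2 * to_ac a * x + to_ac b = 0"
          using x' by (simp add: f pderiv_pCons algebra_simps power_numeral_reduce)
      qed
      with assms D show False by simp
    qed
  qed (simp add: quartic_def)
  then show ?thesis
    unfolding separable_def aroots_def ev_def by (simp add: quartic_def)
qed

section \<open>Isomorphisms of quotient algebras\<close>

lemma ring_of_type_algebra_simps [simp]:
  "carrier ring_of_type_algebra = UNIV"
  "x \<otimes>\<^bsub>ring_of_type_algebra\<^esub> y = x * y"
  "x \<oplus>\<^bsub>ring_of_type_algebra\<^esub> y = x + y"
  "\<zero>\<^bsub>ring_of_type_algebra\<^esub> = 0"
  "\<one>\<^bsub>ring_of_type_algebra\<^esub> = 1"
  by (simp_all add: ring_of_type_algebra_def)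

abbreviation poly_cring :: "'m::field poly ring" where
  "poly_cring \<equiv> ring_of_type_algebra"

definition residue_class :: "'m::field poly \<Rightarrow> 'm poly \<Rightarrow> 'm poly set" where
  "residue_class f r = principal f +>\<^bsub>poly_cring\<^esub> r"

lemma principal_altdef: "principal f = {r. f dvd r}"
  by (auto simp: principal_def cgenideal_def dvd_def mult.commute)

lemma residue_class_altdef: "residue_class f r = {s. f dvd s - r}"
proof -
  have "s \<in> residue_class f r \<longleftrightarrow> (\<exists>h. f dvd h \<and> s = h + r)" for s
    by (auto simp: residue_class_def a_r_coset_def' principal_altdef)
  also have "(\<exists>h. f dvd h \<and> s = h + r) \<longleftrightarrow> f dvd s - r" for s
    by (metis add_diff_cancel_right' diff_add_cancel)
  finally show ?thesis by blast
qed

lemma residue_class_eq_iff: "residue_class f r = residue_class f s \<longleftrightarrow> f dvd r - s"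
proof
  assume "residue_class f r = residue_class f s"
  moreover have "r \<in> residue_class f r" by (simp add: residue_class_altdef)
  ultimately show "f dvd r - s" by (simp add: residue_class_altdef)
next
  assume *: "f dvd r - s"
  have "f dvd q - r \<longleftrightarrow> f dvd q - s" for q
    using dvd_add_right_iff[OF *, of "q - r"] by simp
  then show "residue_class f r = residue_class f s"
    by (simp add: residue_class_altdef)
qed

lemma ideal_principal: "ideal (principal f) poly_cring"
  unfolding principal_def
  by (rule cring.cgenideal_ideal) (auto intro: cring_from_type_algebra)

lemma cring_quotient_algebra: "cring (quotient_algebra f)"
  unfolding quotient_algebra_def
  by (rule ideal.quotient_is_cring[OF ideal_principal cring_from_type_algebra])

lemma residue_class_hom: "residue_class f \<in> ring_hom poly_cring (quotient_algebra f)"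
  using ideal.rcos_ring_hom[OF ideal_principal[of f]]
  by (simp add: residue_class_def[abs_def] quotient_algebra_def)

lemma carrier_quotient_algebra: "carrier (quotient_algebra f) = range (residue_class f)"
  by (auto simp: quotient_algebra_def FactRing_def A_RCOSETS_def' residue_class_def)

lemma scalar_eq: "scalar f c = residue_class f [:c:]"
  by (simp add: scalar_def residue_class_def)

lemma residue_class_simps:
  "residue_class f (r + s) = residue_class f r \<oplus>\<^bsub>quotient_algebra f\<^esub> residue_class f s"
  "residue_class f (r * s) = residue_class f r \<otimes>\<^bsub>quotient_algebra f\<^esub> residue_class f s"
  "residue_class f 1 = \<one>\<^bsub>quotient_algebra f\<^esub>"
  using ring_hom_memE[OF residue_class_hom[of f]] by auto

lemma residue_class_zero: "residue_class f 0 = \<zero>\<^bsub>quotient_algebra f\<^esub>"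
  using ring_hom_zero[OF residue_class_hom[of f]]
  by (simp add: ring_from_type_algebra cring.axioms(1)[OF cring_quotient_algebra])

text \<open>Needed to reverse direction: a polynomial carrying roots of \<open>f\<close> to roots of
  \<open>g\<close> induces a homomorphism from \<open>M[X]/(g)\<close> to
  \<open>M[X]/(f)\<close>.\<close>

lemma isomorphic_algebras_sym:
  assumes "isomorphic_algebras f g"
  shows "isomorphic_algebras g f"
proof -
  from assms obtain h where h: "h \<in> ring_iso (quotient_algebra f) (quotient_algebra g)"
    "\<And>c. h (scalar f c) = scalar g c"
    by (auto simp: isomorphic_algebras_def)
  let ?h' = "inv_into (carrier (quotient_algebra f)) h"
  have "?h' \<in> ring_iso (quotient_algebra g) (quotient_algebra f)"
    by (rule ring_iso_set_sym) (auto simp: h cring.axioms cring_quotient_algebra)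
  moreover have "?h' (scalar g c) = scalar f c" for c
  proof (rule inv_into_f_eq)
    show "inj_on h (carrier (quotient_algebra f))"
      using ring_iso_memE(5)[OF h(1)] by (simp add: bij_betw_def)
    show "scalar f c \<in> carrier (quotient_algebra f)"
      by (simp add: carrier_quotient_algebra scalar_eq)
  qed (rule h)
  ultimately show ?thesis
    by (auto simp: isomorphic_algebras_def)
qed

text \<open>The class of \<open>X\<close> generates the quotient as an algebra, so its image
  determines the homomorphism; the induction follows Horner's scheme.\<close>

lemma algebra_hom_is_substitution:
  assumes h: "h \<in> ring_hom (quotient_algebra g) (quotient_algebra f)"
    and scalar: "\<And>c. h (scalar g c) = scalar f c"
    and y: "h (residue_class g [:0, 1:]) = residue_class f y"
  shows "h (residue_class g r) = residue_class f (pcompose r y)"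
proof (induction r)
  case 0
  show ?case using scalar[of 0] by (simp add: scalar_eq)
next
  case (pCons c r)
  have "pCons c r = [:c:] + [:0, 1:] * r" by simp
  then have "residue_class g (pCons c r) = residue_class g [:c:] \<oplus>\<^bsub>quotient_algebra g\<^esub>
      residue_class g [:0, 1:] \<otimes>\<^bsub>quotient_algebra g\<^esub> residue_class g r"
    by (metis residue_class_simps(1,2))
  moreover have "residue_class g s \<in> carrier (quotient_algebra g)" for s
    by (simp add: carrier_quotient_algebra)
  moreover have "residue_class g r \<otimes>\<^bsub>quotient_algebra g\<^esub> residue_class g s
      \<in> carrier (quotient_algebra g)" for r s
    by (simp add: carrier_quotient_algebra flip: residue_class_simps)
  ultimately have "h (residue_class g (pCons c r)) = h (residue_class g [:c:])
      \<oplus>\<^bsub>quotient_algebra f\<^esub> h (residue_class g [:0, 1:]) \<otimes>\<^bsub>quotient_algebra f\<^esub> h (residue_class g r)"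
    by (simp add: ring_hom_add[OF h] ring_hom_mult[OF h])
  then show ?case
    using scalar[of c] y pCons.IH
    by (simp add: scalar_eq pcompose_pCons flip: residue_class_simps)
qed

text \<open>The equivalence of divisibilities expresses that substituting \<open>y\<close> is well
  defined and injective on classes. Surjectivity only has to be tested on the generator
  \<open>X\<close>, which is the condition on \<open>w\<close>.\<close>

lemma isomorphic_algebras_iff_substitution:
  "isomorphic_algebras g f \<longleftrightarrow>
    (\<exists>y. (\<forall>r. f dvd pcompose r y \<longleftrightarrow> g dvd r) \<and> (\<exists>w. f dvd pcompose w y - [:0, 1:]))"
proof
  assume "isomorphic_algebras g f"
  then obtain h where h: "h \<in> ring_iso (quotient_algebra g) (quotient_algebra f)"
    and scalar: "\<And>c. h (scalar g c) = scalar f c"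
    by (auto simp: isomorphic_algebras_def)
  have hom: "h \<in> ring_hom (quotient_algebra g) (quotient_algebra f)"
    and bij: "bij_betw h (carrier (quotient_algebra g)) (carrier (quotient_algebra f))"
    using h by (auto simp: ring_iso_def)
  have "h (residue_class g [:0, 1:]) \<in> carrier (quotient_algebra f)"
    using ring_hom_memE(1)[OF hom] by (simp add: carrier_quotient_algebra)
  then obtain y where "h (residue_class g [:0, 1:]) = residue_class f y"
    by (auto simp: carrier_quotient_algebra)
  note subst = algebra_hom_is_substitution[OF hom scalar this]
  have "f dvd pcompose r y \<longleftrightarrow> g dvd r" for r
  proof -
    have "f dvd pcompose r y \<longleftrightarrow> h (residue_class g r) = h (residue_class g 0)"
      by (simp add: subst residue_class_eq_iff)
    also have "\<dots> \<longleftrightarrow> residue_class g r = residue_class g 0"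
      using bij by (auto simp: bij_betw_def carrier_quotient_algebra dest: inj_onD)
    finally show ?thesis by (simp add: residue_class_eq_iff)
  qed
  moreover have "\<exists>w. f dvd pcompose w y - [:0, 1:]"
  proof -
    have "residue_class f [:0, 1:] \<in> h ` range (residue_class g)"
      using bij by (auto simp: bij_betw_def carrier_quotient_algebra)
    then obtain w where "residue_class f [:0, 1:] = h (residue_class g w)"
      by auto
    then show ?thesis by (metis subst residue_class_eq_iff)
  qed
  ultimately show "\<exists>y. (\<forall>r. f dvd pcompose r y \<longleftrightarrow> g dvd r) \<and> (\<exists>w. f dvd pcompose w y - [:0, 1:])"
    by blast
next
  assume "\<exists>y. (\<forall>r. f dvd pcompose r y \<longleftrightarrow> g dvd r) \<and> (\<exists>w. f dvd pcompose w y - [:0, 1:])"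
  then obtain y w where y: "\<And>r. f dvd pcompose r y \<longleftrightarrow> g dvd r"
    and w: "f dvd pcompose w y - [:0, 1:]" by blast
  let ?h = "\<lambda>r. residue_class f (pcompose r y)"
  have "?h \<in> ring_hom poly_cring (quotient_algebra f)"
    by (rule ring_hom_memI)
      (simp_all add: carrier_quotient_algebra pcompose_mult pcompose_add pcompose_1 residue_class_simps)
  from ring_hom_ringI2[OF ring_from_type_algebra cring.axioms(1)[OF cring_quotient_algebra] this]
  have h: "ring_hom_ring poly_cring (quotient_algebra f) ?h" .
  have "a_kernel poly_cring (quotient_algebra f) ?h = {r. ?h r = residue_class f 0}"
    using residue_class_zero[of f] by (auto simp: a_kernel_def')
  also have "\<dots> = principal g"
    by (simp add: residue_class_eq_iff y principal_altdef)
  finally have ker: "a_kernel poly_cring (quotient_algebra f) ?h = principal g" .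
  have "residue_class f r \<in> range ?h" for r
  proof -
    \<comment> \<open>Since \<open>w\<close> composed with \<open>y\<close> is congruent to
      \<open>X\<close> modulo \<open>f\<close>, substituting it into any \<open>r\<close> returns
      \<open>r\<close> modulo \<open>f\<close>; this exhibits a preimage of every class.\<close>
    have "f dvd pcompose r (pcompose w y) - pcompose r [:0, 1:]"
    proof (induction r)
      case (pCons c r)
      have "pcompose (pCons c r) (pcompose w y) - pcompose (pCons c r) [:0, 1:] =
          (pcompose w y - [:0, 1:]) * pcompose r (pcompose w y)
          + [:0, 1:] * (pcompose r (pcompose w y) - pcompose r [:0, 1:])"
        by (simp add: pcompose_pCons algebra_simps)
      with pCons.IH w show ?case by (metis dvd_add dvd_mult dvd_mult2)
    qed simp
    then have "residue_class f r = ?h (pcompose r w)"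
      by (simp add: residue_class_eq_iff pcompose_assoc dvd_diff_commute)
    then show ?thesis by simp
  qed
  then have "?h ` carrier poly_cring = carrier (quotient_algebra f)"
    by (auto simp: carrier_quotient_algebra)
  \<comment> \<open>First isomorphism theorem for a surjection from \<open>M[X]\<close> with kernel
    generated by \<open>g\<close>.\<close>
  note iso = ring_hom_ring.FactRing_iso_set[OF h this]
  define \<phi> where "\<phi> = (\<lambda>x. the_elem (?h ` x))"
  have "\<phi> \<in> ring_iso (quotient_algebra g) (quotient_algebra f)"
    using iso unfolding ker \<phi>_def by (simp add: quotient_algebra_def)
  moreover have "\<phi> (scalar g c) = scalar f c" for c
    unfolding \<phi>_def
    using ring_hom_ring.the_elem_simp[OF h, of "[:c:]", unfolded ker]
    by (simp add: scalar_def residue_class_def)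
  ultimately show "isomorphic_algebras g f"
    unfolding isomorphic_algebras_def by blast
qed

text \<open>
  Injectivity makes \<open>y^i mod f\<close>, \<open>i < deg f\<close>, linearly independent; by dimension they span the
  polynomials of degree below \<open>deg f\<close>.
\<close>

lemma substitution_surj_if_inj:
  fixes f g y :: "'m::field poly"
  assumes deg: "Polynomial.degree f = Polynomial.degree g" "Polynomial.degree f > 0"
    and inj: "\<And>r. f dvd pcompose r y \<Longrightarrow> g dvd r"
  shows "\<exists>w. f dvd pcompose w y - [:0, 1:]"
proof -
  interpret vs: vector_space "Polynomial.smult :: 'm \<Rightarrow> 'm poly \<Rightarrow> 'm poly"
    by unfold_locales (auto simp: smult_add_left smult_add_right)
  define n where "n = Polynomial.degree f"
  define \<psi> where "\<psi> i = y ^ i mod f" for i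
  define comb where "comb c = (\<Sum>i<n. monom (c i) i)" for c :: "nat \<Rightarrow> 'm"
  have coeff_comb: "Polynomial.coeff (comb c) i = (if i < n then c i else 0)" for c i
    by (simp add: comb_def coeff_sum)
  have comb_mod: "pcompose (comb c) y mod f = (\<Sum>i<n. Polynomial.smult (c i) (\<psi> i))" for c
  proof -
    have "pcompose (monom a i) y = Polynomial.smult a (y ^ i)" for a i
      by (induction i) (simp_all add: monom_0 monom_Suc pcompose_pCons)
    then have "pcompose (comb c) y mod f = (\<Sum>i<n. Polynomial.smult (c i) (y ^ i)) mod f"
      by (simp add: comb_def pcompose_sum)
    also have "\<dots> = (\<Sum>i<n. Polynomial.smult (c i) (y ^ i) mod f)"
      by (induction n) (simp_all add: poly_mod_add_left)
    finally show ?thesis by (simp add: \<psi>_def mod_smult_left)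
  qed
  \<comment> \<open>A linear relation among the reduced powers of \<open>y\<close> is a polynomial
    of degree below \<open>deg g\<close> divisible by \<open>g\<close>, hence zero.\<close>
  have zero: "c i = 0" if "(\<Sum>i<n. Polynomial.smult (c i) (\<psi> i)) = 0" "i < n" for c i
  proof -
    have "g dvd comb c"
      by (rule inj) (use that comb_mod[of c] in auto)
    moreover have "Polynomial.degree (comb c) < Polynomial.degree g"
      using deg by (intro degree_lessI) (auto simp: coeff_comb n_def)
    ultimately have "comb c = 0" using dvd_imp_degree_le by force
    then show ?thesis using coeff_comb[of c i] that by simp
  qed
  have inj_\<psi>: "inj_on \<psi> {..<n}"
  proof (rule inj_onI, rule ccontr)
    fix i j assume ij: "i \<in> {..<n}" "j \<in> {..<n}" "\<psi> i = \<psi> j" "i \<noteq> j"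
    \<comment> \<open>Two equal reduced powers would give the nontrivial relation with coefficients
      1 and -1.\<close>
    define c :: "nat \<Rightarrow> 'm" where "c = (\<lambda>k. if k = i then 1 else if k = j then -1 else 0)"
    have "(\<Sum>k<n. Polynomial.smult (c k) (\<psi> k)) = (\<Sum>k\<in>{i, j}. Polynomial.smult (c k) (\<psi> k))"
      using ij by (intro sum.mono_neutral_right) (auto simp: c_def)
    also have "\<dots> = 0" using ij by (simp add: c_def)
    finally have "c i = 0" using ij zero by auto
    then show False by (simp add: c_def)
  qed
  have indep: "vs.independent (\<psi> ` {..<n})"
  proof (rule vs.independent_if_scalars_zero)
    fix c x assume "(\<Sum>x\<in>\<psi> ` {..<n}. Polynomial.smult (c x) x) = 0" "x \<in> \<psi> ` {..<n}"
    then show "c x = 0"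
      using zero[of "c \<circ> \<psi>"] by (auto simp: sum.reindex[OF inj_\<psi>])
  qed simp
  have low_degree: "r mod f \<in> vs.span (monom 1 ` {..<n})" for r
  proof -
    have "r mod f = (\<Sum>i\<le>n - 1. monom (Polynomial.coeff (r mod f) i) i)"
      by (rule poly_as_sum_of_monoms'[symmetric])
        (use degree_mod_less[of f r] deg(2) in \<open>fastforce simp: n_def\<close>)
    also have "\<dots> = (\<Sum>i\<le>n - 1. Polynomial.smult (Polynomial.coeff (r mod f) i) (monom 1 i))"
      by (simp add: smult_monom)
    also have "\<dots> \<in> vs.span (monom 1 ` {..<n})"
      using deg by (intro vs.span_sum vs.span_scale vs.span_base) (auto simp: n_def)
    finally show ?thesis .
  qed
  have "[:0, 1:] mod f \<in> vs.span (\<psi> ` {..<n})"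
  proof (rule ccontr)
    \<comment> \<open>Otherwise \<open>n + 1\<close> independent vectors would lie in a space
      spanned by \<open>n\<close> monomials.\<close>
    assume *: "[:0, 1:] mod f \<notin> vs.span (\<psi> ` {..<n})"
    then have "vs.independent (insert ([:0, 1:] mod f) (\<psi> ` {..<n}))"
      using indep by (rule vs.independent_insertI)
    moreover have "insert ([:0, 1:] mod f) (\<psi> ` {..<n}) \<subseteq> vs.span (monom 1 ` {..<n})"
      using low_degree by (auto simp: \<psi>_def)
    ultimately have "card (insert ([:0, 1:] mod f) (\<psi> ` {..<n})) \<le> card (monom (1::'m) ` {..<n})"
      using vs.independent_span_bound by blast
    also have "\<dots> \<le> n"
      using card_image_le[of "{..<n}"] by simp
    finally show False
      using * by (auto simp: card_image[OF inj_\<psi>] vs.span_base card_insert_if split: if_splits)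
  qed
  then obtain c where "[:0, 1:] mod f = (\<Sum>x\<in>\<psi> ` {..<n}. Polynomial.smult (c x) x)"
    using vs.span_finite[of "\<psi> ` {..<n}"] by auto
  also have "\<dots> = pcompose (comb (c \<circ> \<psi>)) y mod f"
    by (simp add: sum.reindex[OF inj_\<psi>] comb_mod)
  finally show ?thesis
    by (metis mod_eq_dvd_iff)
qed

text \<open>Separability turns both divisibility conditions into vanishing at roots. Equal root
  counts upgrade an injection to a bijection, and the dimension argument supplies the inverse
  polynomial over \<open>M\<close>.\<close>

lemma isomorphic_algebras_iff_root_bijection:
  assumes f: "separable f" and g: "separable g"
    and deg: "Polynomial.degree f = Polynomial.degree g" "Polynomial.degree f > 0"
  shows "isomorphic_algebras f g \<longleftrightarrow> (\<exists>y. bij_betw (\<lambda>x. ev x y) (aroots f) (aroots g))"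
proof -
  note dvd_f = dvd_iff_vanishes_on_aroots[OF f deg(2)]
  note dvd_g = dvd_iff_vanishes_on_aroots[OF g deg(2)[unfolded deg(1)]]
  have fin: "finite (aroots f)" "finite (aroots g)"
    using f g by (auto simp: separable_def finite_aroots)
  have card: "card (aroots f) = card (aroots g)"
    using f g deg by (simp add: separable_def)
  have "isomorphic_algebras f g \<longleftrightarrow> isomorphic_algebras g f"
    by (auto intro: isomorphic_algebras_sym)
  also have "\<dots> \<longleftrightarrow>
      (\<exists>y. (\<forall>r. f dvd pcompose r y \<longleftrightarrow> g dvd r) \<and> (\<exists>w. f dvd pcompose w y - [:0, 1:]))"
    by (rule isomorphic_algebras_iff_substitution)
  also have "\<dots> \<longleftrightarrow> (\<exists>y. bij_betw (\<lambda>x. ev x y) (aroots f) (aroots g))"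
  proof (rule ex_cong1, rule iffI, elim conjE exE)
    fix y w
    assume y: "\<forall>r. f dvd pcompose r y \<longleftrightarrow> g dvd r" and w: "f dvd pcompose w y - [:0, 1:]"
    have "(\<lambda>x. ev x y) ` aroots f \<subseteq> aroots g"
      using y[rule_format, of g] by (auto simp: dvd_f aroots_def)
    moreover have "inj_on (\<lambda>x. ev x y) (aroots f)"
    proof (rule inj_on_inverseI)
      \<comment> \<open>The polynomial \<open>w\<close> recovers each root of \<open>f\<close> from
        its image under \<open>y\<close>.\<close>
      show "ev (ev x y) w = x" if "x \<in> aroots f" for x
        using w that by (auto simp: dvd_f)
    qed
    ultimately show "bij_betw (\<lambda>x. ev x y) (aroots f) (aroots g)"
      using fin card by (metis bij_betw_def card_image card_subset_eq)
  next
    fix y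
    assume bij: "bij_betw (\<lambda>x. ev x y) (aroots f) (aroots g)"
    \<comment> \<open>The values of \<open>r\<close> composed with \<open>y\<close> on the roots of
      \<open>f\<close> are the values of \<open>r\<close> on the image, which is all of
      \<open>aroots g\<close>.\<close>
    have y: "f dvd pcompose r y \<longleftrightarrow> g dvd r" for r
      unfolding dvd_f dvd_g bij_betw_imp_surj_on[OF bij, symmetric] by simp
    have "\<exists>w. f dvd pcompose w y - [:0, 1:]"
      by (rule substitution_surj_if_inj) (use deg y in auto)
    with y show "(\<forall>r. f dvd pcompose r y \<longleftrightarrow> g dvd r) \<and> (\<exists>w. f dvd pcompose w y - [:0, 1:])"
      by blast
  qed
  finally show ?thesis .
qed

section \<open>Images of the roots of a quartic\<close>

text \<open>Instead of running over the roots of the quartic, factor the quadratic minus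
  \<open>\<tau>\<close>: the value \<open>\<tau>\<close> is attained at a root of \<open>f\<close>
  exactly when \<open>f\<close> vanishes at one of the two points \<open>\<alpha>\<close>,
  \<open>\<beta>\<close>.\<close>

lemma quadratic_image_of_roots:
  fixes s t p \<tau> :: "'a::alg_closed_field"
  assumes two: "(2::'a) \<noteq> 0"
  shows "(\<exists>\<xi>. \<xi>^4 + s * \<xi>^2 + t * \<xi> + t = 0 \<and> 2 * \<xi>^2 + p * \<xi> + s = \<tau>) \<longleftrightarrow>
    \<tau>^4 + P s t p * \<tau>^2 + Q s t p * \<tau> + R s t p = 0"
proof -
  define f where "f x = x^4 + s * x^2 + t * x + t" for x
  obtain \<alpha> where "poly [:s - \<tau>, p, 2:] \<alpha> = 0"
    using alg_closed_imp_poly_has_root[of "[:s - \<tau>, p, 2:]"] two by auto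
  then have \<alpha>: "2 * \<alpha>^2 + p * \<alpha> + s = \<tau>"
    by (simp add: algebra_simps power2_eq_square)
  \<comment> \<open>The second root, from Vieta's formula for the sum.\<close>
  define \<beta> where "\<beta> = - p / 2 - \<alpha>"
  have p: "p = -2 * (\<alpha> + \<beta>)"
    using two by (simp add: \<beta>_def field_simps)
  have \<tau>: "\<tau> = s - 2 * (\<alpha> * \<beta>)"
    unfolding \<alpha>[symmetric] p by Groebner_Basis.algebra
  have "2 * \<xi>^2 + p * \<xi> + s - \<tau> = 2 * ((\<xi> - \<alpha>) * (\<xi> - \<beta>))" for \<xi>
    unfolding p \<tau> by Groebner_Basis.algebra
  then have "2 * \<xi>^2 + p * \<xi> + s = \<tau> \<longleftrightarrow> \<xi> = \<alpha> \<or> \<xi> = \<beta>" for \<xi>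
    using two by (metis eq_iff_diff_eq_0 mult_eq_0_iff)
  then have "(\<exists>\<xi>. f \<xi> = 0 \<and> 2 * \<xi>^2 + p * \<xi> + s = \<tau>) \<longleftrightarrow> f \<alpha> * f \<beta> = 0"
    by auto
  also have "\<dots> \<longleftrightarrow> 2^4 * (f \<alpha> * f \<beta>) = 0"
    using two by (simp only: mult_eq_0_iff power_eq_0_iff) simp
  also have "2^4 * (f \<alpha> * f \<beta>) = \<tau>^4 + P s t p * \<tau>^2 + Q s t p * \<tau> + R s t p"
    unfolding p \<tau> f_def quadratic_resultant by simp
  finally show ?thesis unfolding f_def .
qed

lemma cubic_image_of_roots:
  fixes s t u v \<tau> :: "'a::alg_closed_field"
  assumes two: "(2::'a) \<noteq> 0"
  shows "(\<exists>\<xi>. \<xi>^4 + s * \<xi>^2 + t * \<xi> + t = 0 \<and>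
      4 * \<xi>^3 + 2 * v * \<xi>^2 + u * \<xi> + 3 * t + s * v = \<tau>) \<longleftrightarrow>
    \<tau>^4 + U s t u v * \<tau>^2 - V s t u v * \<tau> + W s t u v = 0"
proof -
  define f where "f x = x^4 + s * x^2 + t * x + t" for x
  have four: "(4::'a) \<noteq> 0"
    using two by (metis mult_2 mult_eq_0_iff numeral_Bit0)
  obtain \<alpha> where "poly [:3 * t + s * v - \<tau>, u, 2 * v, 4:] \<alpha> = 0"
    using alg_closed_imp_poly_has_root[of "[:3 * t + s * v - \<tau>, u, 2 * v, 4:]"] four by auto
  then have \<alpha>: "4 * \<alpha>^3 + 2 * v * \<alpha>^2 + u * \<alpha> + 3 * t + s * v = \<tau>"
    by (simp add: algebra_simps power2_eq_square power3_eq_cube)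
  \<comment> \<open>This quadratic is the quotient of the cubic minus \<open>\<tau>\<close> by
    \<open>X - \<alpha>\<close>; the third root \<open>\<gamma>\<close> then comes from the sum of
    the roots.\<close>
  obtain \<beta> where "poly [:u + 2 * v * \<alpha> + 4 * \<alpha>^2, 2 * v + 4 * \<alpha>, 4:] \<beta> = 0"
    using alg_closed_imp_poly_has_root[of "[:u + 2 * v * \<alpha> + 4 * \<alpha>^2, 2 * v + 4 * \<alpha>, 4:]"] four by auto
  then have \<beta>: "u + 2 * v * \<alpha> + 4 * \<alpha>^2 + (2 * v + 4 * \<alpha>) * \<beta> + 4 * \<beta>^2 = 0"
    by (simp add: algebra_simps power2_eq_square)
  define \<gamma> where "\<gamma> = - v / 2 - \<alpha> - \<beta>"
  define e1 e2 e3 where e: "e1 = \<alpha> + \<beta> + \<gamma>" "e2 = \<alpha> * \<beta> + \<beta> * \<gamma> + \<gamma> * \<alpha>" "e3 = \<alpha> * \<beta> * \<gamma>"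
  have v: "v = -2 * e1"
    using two by (simp add: \<gamma>_def e field_simps)
  have u: "u = 4 * e2"
    using \<beta> unfolding v e by Groebner_Basis.algebra
  have \<tau>: "\<tau> = 3 * t + s * v + 4 * e3"
    unfolding \<alpha>[symmetric] u v e by Groebner_Basis.algebra
  have "4 * \<xi>^3 + 2 * v * \<xi>^2 + u * \<xi> + 3 * t + s * v - \<tau> = 4 * ((\<xi> - \<alpha>) * (\<xi> - \<beta>) * (\<xi> - \<gamma>))" for \<xi>
    unfolding \<tau> u v e by Groebner_Basis.algebra
  then have "4 * \<xi>^3 + 2 * v * \<xi>^2 + u * \<xi> + 3 * t + s * v = \<tau> \<longleftrightarrow> \<xi> = \<alpha> \<or> \<xi> = \<beta> \<or> \<xi> = \<gamma>" for \<xi>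
    using four by (metis eq_iff_diff_eq_0 mult_eq_0_iff)
  then have "(\<exists>\<xi>. f \<xi> = 0 \<and> 4 * \<xi>^3 + 2 * v * \<xi>^2 + u * \<xi> + 3 * t + s * v = \<tau>) \<longleftrightarrow>
      f \<alpha> * f \<beta> * f \<gamma> = 0"
    by auto
  also have "\<dots> \<longleftrightarrow> 4^4 * (f \<alpha> * f \<beta> * f \<gamma>) = 0"
    using four by (simp only: mult_eq_0_iff power_eq_0_iff) simp
  also have "4^4 * (f \<alpha> * f \<beta> * f \<gamma>) = \<tau>^4 + U s t u v * \<tau>^2 - V s t u v * \<tau> + W s t u v"
  proof -
    \<comment> \<open>At the roots of the cubic the quartic agrees with its remainder modulo the
      cubic.\<close>
    define r0 r1 r2 where r: "r0 = e1 * e3 + t" "r1 = e3 - e1 * e2 + t" "r2 = e1^2 - e2 + s"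
    have "f \<alpha> = r0 + r1 * \<alpha> + r2 * \<alpha>^2" "f \<beta> = r0 + r1 * \<beta> + r2 * \<beta>^2"
      "f \<gamma> = r0 + r1 * \<gamma> + r2 * \<gamma>^2"
      unfolding f_def r e by Groebner_Basis.algebra+
    then show ?thesis
      unfolding \<tau> u v cubic_charpoly by (simp add: norm_of_quadratic[OF e] r)
  qed
  finally show ?thesis unfolding f_def .
qed

section \<open>The characteristic and the comparison of coefficients\<close>

lemma two_nonzero_if_characteristic:
  fixes k :: "'m::field set"
  assumes "characteristic ((ring_of_type_algebra :: 'm ring)\<lparr>carrier := k\<rparr>) \<noteq> 2"
  shows "(2::'m) \<noteq> 0"
proof
  assume two: "(2::'m) = 0"
  let ?k = "(ring_of_type_algebra :: 'm ring)\<lparr>carrier := k\<rparr>"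
  \<comment> \<open>Restricting the carrier leaves the operations unchanged, so multiples of one are
    computed in \<open>M\<close>.\<close>
  have "[n] \<cdot>\<^bsub>?k\<^esub> \<one>\<^bsub>?k\<^esub> = of_nat n" for n :: nat
    by (induction n) (simp_all add: add_pow_def nat_pow_def)
  then have char: "characteristic ?k = Gcd {n. of_nat n = (0::'m)}"
    by (simp add: characteristic_def)
  have "of_nat n = (0::'m) \<longleftrightarrow> even n" for n
  proof (cases "even n")
    case True
    then show ?thesis using two by (auto elim!: evenE)
  next
    case False
    then show ?thesis using two by (auto elim!: oddE)
  qed
  then have "characteristic ?k = Gcd {n. even n}"
    by (simp add: char)
  also have "\<dots> = 2"
    by (rule dvd_antisym) (auto intro: Gcd_dvd Gcd_greatest)
  finally show False using assms by contradiction
qed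

lemma ev_quartic: "ev x (quartic a b) = x^4 + to_ac a * x^2 + to_ac b * x + to_ac b"
  by (simp add: quartic_def algebra_simps power_numeral_reduce)

text \<open>Forwards, two monic quartics sharing four distinct roots have equal coefficients.
  Backwards, the scaling factor \<open>B / C\<close> makes the image contain the four target roots,
  and counting gives bijectivity. Only the set of values of \<open>z\<close> enters, so
  multiplicities need no separate treatment.\<close>

lemma affine_image_is_quartic_iff:
  fixes a b a' b' :: "'m::field"
  assumes two: "(2::'m) \<noteq> 0" and D: "D a b \<noteq> 0" "D a' b' \<noteq> 0"
    and image: "\<And>\<tau>. (\<exists>\<xi>. ev \<xi> (quartic a b) = 0 \<and> ev \<xi> z = \<tau>) \<longleftrightarrow>
      ev \<tau> [:C, B, A, 0, 1:] = 0"
  shows "(\<exists>c \<mu>. bij_betw (\<lambda>x. ev x ([:c:] + Polynomial.smult \<mu> z))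
      (aroots (quartic a b)) (aroots (quartic a' b'))) \<longleftrightarrow>
    C \<noteq> 0 \<and> a' = A * B^2 / C^2 \<and> b' = B^4 / C^3" (is "?bij \<longleftrightarrow> ?coeffs")
proof -
  have card: "card (aroots (quartic a b)) = 4" "card (aroots (quartic a' b')) = 4"
    using D[THEN separable_if_D_nonzero] by (simp_all add: separable_def quartic_def)
  have fin: "finite (aroots (quartic a b))" "finite (aroots (quartic a' b'))"
    by (simp_all add: finite_aroots quartic_def)
  have b': "b' \<noteq> 0" using D(2) by (auto simp: D_def)
  have four: "(4::'m) \<noteq> 0"
    using two by (metis mult_2 mult_eq_0_iff numeral_Bit0)
  show ?thesis
  proof
    assume ?bij
    then obtain c \<mu> where bij: "bij_betw (\<lambda>x. to_ac c + to_ac \<mu> * ev x z)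
      (aroots (quartic a b)) (aroots (quartic a' b'))"
      by auto
    \<comment> \<open>With \<open>G = X^4 + AX^2 + BX + C\<close>, this is
      \<open>\<mu>^4 G((X - c) / \<mu>)\<close> with denominators cleared, so that it also makes
      sense before \<open>\<mu> \<noteq> 0\<close> is known.\<close>
    define h where "h = [:c^4 + A * \<mu>^2 * c^2 - B * \<mu>^3 * c + C * \<mu>^4,
      - 4 * c^3 - 2 * A * \<mu>^2 * c + B * \<mu>^3, 6 * c^2 + A * \<mu>^2, - 4 * c, 1:]"
    have "\<mu> \<noteq> 0"
    proof
      assume "\<mu> = 0"
      then have "aroots (quartic a' b') \<subseteq> {to_ac c}"
        using bij by (auto simp: bij_betw_def)
      from card_mono[OF _ this] show False by (simp add: card)
    qed
    have "quartic a' b' - h = 0"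
    proof (rule eq_0_if_many_roots)
      show "Polynomial.degree (quartic a' b' - h) < card (aroots (quartic a' b'))"
        unfolding card
        by (intro degree_lessI) (auto simp: quartic_def h_def coeff_pCons split: nat.splits)
      fix x assume x: "x \<in> aroots (quartic a' b')"
      then obtain \<xi> where \<xi>: "\<xi> \<in> aroots (quartic a b)" "x = to_ac c + to_ac \<mu> * ev \<xi> z"
        using bij by (auto simp: bij_betw_def)
      have "ev (ev \<xi> z) [:C, B, A, 0, 1:] = 0"
        using image \<xi> by (auto simp: aroots_def)
      moreover have "ev x h = to_ac \<mu> ^ 4 * ev (ev \<xi> z) [:C, B, A, 0, 1:]"
        unfolding h_def \<xi> by (simp add: algebra_simps power_numeral_reduce)
      ultimately show "ev x (quartic a' b' - h) = 0"
        using x by (simp add: aroots_def)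
    qed
    then have h: "quartic a' b' = h" by simp
    \<comment> \<open>The cubic coefficient \<open>-4c\<close> must vanish.\<close>
    then have c: "c = 0"
      using four by (simp add: quartic_def h_def)
    then have *: "a' = A * \<mu>^2" "b' = B * \<mu>^3" "b' = C * \<mu>^4"
      using h by (auto simp: quartic_def h_def)
    have C: "C \<noteq> 0" using b' *(3) by auto
    \<comment> \<open>The linear and constant coefficients of the target are both \<open>b'\<close>,
      which pins down \<open>\<mu>\<close>.\<close>
    have "\<mu>^3 * B = \<mu>^3 * (C * \<mu>)"
      using *(2,3) by Groebner_Basis.algebra
    then have "\<mu> = B / C" using \<open>\<mu> \<noteq> 0\<close> C by simp
    with C * show ?coeffs
      by (simp add: power_divide power_numeral_reduce)
  next
    assume ?coeffs
    then have C: "C \<noteq> 0" and a'b': "a' = A * B^2 / C^2" "b' = B^4 / C^3" by auto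
    define \<mu> where "\<mu> = B / C"
    \<comment> \<open>\<open>B = 0\<close> would give \<open>b' = 0\<close>, but \<open>b'\<close>
      is a factor of the nonzero \<open>D a' b'\<close>.\<close>
    have "\<mu> \<noteq> 0" using b' a'b' C by (auto simp: \<mu>_def)
    let ?y = "[:0:] + Polynomial.smult \<mu> z"
    have *: "a' = A * \<mu>^2" "b' = B * \<mu>^3" "b' = C * \<mu>^4"
      using C by (simp_all add: a'b' \<mu>_def power_divide power_numeral_reduce)
    have sub: "aroots (quartic a' b') \<subseteq> (\<lambda>x. ev x ?y) ` aroots (quartic a b)"
    proof
      fix \<tau> assume \<tau>: "\<tau> \<in> aroots (quartic a' b')"
      define \<sigma> where "\<sigma> = \<tau> / to_ac \<mu>"
      have \<tau>_eq: "\<tau> = to_ac \<mu> * \<sigma>" using \<open>\<mu> \<noteq> 0\<close> by (simp add: \<sigma>_def)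
      have "ev \<tau> (quartic a' b') =
        \<tau>^4 + to_ac (A * \<mu>^2) * \<tau>^2 + to_ac (B * \<mu>^3) * \<tau> + to_ac (C * \<mu>^4)"
        unfolding ev_quartic using * by metis
      also have "\<dots> = to_ac \<mu> ^ 4 * ev \<sigma> [:C, B, A, 0, 1:]"
        by (simp add: \<tau>_eq algebra_simps power_numeral_reduce)
      finally have "ev \<sigma> [:C, B, A, 0, 1:] = 0"
        using \<tau> \<open>\<mu> \<noteq> 0\<close> by (simp add: aroots_def)
      then obtain \<xi> where "ev \<xi> (quartic a b) = 0" "ev \<xi> z = \<sigma>"
        using image by blast
      then show "\<tau> \<in> (\<lambda>x. ev x ?y) ` aroots (quartic a b)"
        by (intro image_eqI[of _ _ \<xi>]) (simp_all add: aroots_def \<tau>_eq)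
    qed
    \<comment> \<open>An image of at most four points containing the four target roots equals them,
      and the map is injective by counting.\<close>
    moreover have le: "card ((\<lambda>x. ev x ?y) ` aroots (quartic a b)) \<le> 4"
      using card_image_le[OF fin(1)] card by metis
    ultimately have surj: "(\<lambda>x. ev x ?y) ` aroots (quartic a b) = aroots (quartic a' b')"
      using card_seteq[OF finite_imageI[OF fin(1)] sub] card by simp
    then have "inj_on (\<lambda>x. ev x ?y) (aroots (quartic a b))"
      using card fin by (intro eq_card_imp_inj_on) simp_all
    with surj show ?bij unfolding bij_betw_def by blast
  qed
qed

theorem theorem3p3:
  fixes k :: "'m::field set" and a b a' b' :: 'm
  assumes "subfield k (ring_of_type_algebra :: 'm ring)"
    and "characteristic ((ring_of_type_algebra :: 'm ring)\<lparr>carrier := k\<rparr>) \<noteq> 2"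
    and "infinite (UNIV :: 'm set)"
    and "(a, b) \<noteq> (a', b')"
    and "D a b * D a' b' \<noteq> 0"
  shows "isomorphic_algebras (quartic a b) (quartic a' b') \<longleftrightarrow>
    (\<exists>p. R a b p \<noteq> 0 \<and>
       a' = P a b p * (Q a b p)^2 / (R a b p)^2 \<and>
       b' = (Q a b p)^4 / (R a b p)^3) \<or>
    (\<exists>u v. W a b u v \<noteq> 0 \<and>
       a' = U a b u v * (V a b u v)^2 / (W a b u v)^2 \<and>
       b' = (V a b u v)^4 / (W a b u v)^3)"
proof -
  let ?f = "quartic a b" and ?g = "quartic a' b'"
  define transports where "transports y \<longleftrightarrow> bij_betw (\<lambda>x. ev x y) (aroots ?f) (aroots ?g)" for y
  \<comment> \<open>Translation and scaling are left free, so that \<open>z\<close> can be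
    normalised to trace zero with a fixed leading coefficient.\<close>
  define affine where "affine z \<longleftrightarrow> (\<exists>c \<mu>. transports ([:c:] + Polynomial.smult \<mu> z))" for z
  have two: "(2::'m) \<noteq> 0" using assms(2) by (rule two_nonzero_if_characteristic)
  have two': "(2::'m alg_closure) \<noteq> 0"
    using two to_ac_eq_0_iff[of "2::'m"] by simp
  have four: "(4::'m) \<noteq> 0"
    using two by (metis mult_2 mult_eq_0_iff numeral_Bit0)
  have D: "D a b \<noteq> 0" "D a' b' \<noteq> 0" using assms(5) by auto
  note affine_iff = affine_image_is_quartic_iff[OF two D, folded transports_def, folded affine_def]
  have b: "b \<noteq> 0" using D by (auto simp: D_def)

  \<comment> \<open>For \<open>z = x\<close> the image quartic is the original one, so the criterion
    yields \<open>a' = a\<close> and \<open>b' = b\<close>, which is excluded.\<close>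
  have linear: "\<not> affine [:0, 1:]"
  proof -
    have "affine [:0, 1:] \<longleftrightarrow> b \<noteq> 0 \<and> a' = a * b^2 / b^2 \<and> b' = b^4 / b^3"
      by (rule affine_iff) (auto simp: quartic_def)
    then show ?thesis using assms(4) b by (auto simp: power_numeral_reduce)
  qed
  have quadratic: "affine [:a, p, 2:] \<longleftrightarrow> R a b p \<noteq> 0 \<and>
      a' = P a b p * (Q a b p)^2 / (R a b p)^2 \<and> b' = (Q a b p)^4 / (R a b p)^3" for p
  proof (rule affine_iff)
    fix \<tau>
    have "to_ac (P a b p) = P (to_ac a) (to_ac b) (to_ac p)"
      "to_ac (Q a b p) = Q (to_ac a) (to_ac b) (to_ac p)"
      "to_ac (R a b p) = R (to_ac a) (to_ac b) (to_ac p)"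
      by (simp_all add: P_def Q_def R_def)
    then show "(\<exists>\<xi>. ev \<xi> ?f = 0 \<and> ev \<xi> [:a, p, 2:] = \<tau>) \<longleftrightarrow>
        ev \<tau> [:R a b p, Q a b p, P a b p, 0, 1:] = 0"
      using quadratic_image_of_roots[OF two', of "to_ac a" "to_ac b" "to_ac p" \<tau>]
      by (simp add: ev_quartic algebra_simps power_numeral_reduce)
  qed
  have cubic: "affine [:3 * b + a * v, u, 2 * v, 4:] \<longleftrightarrow> W a b u v \<noteq> 0 \<and>
      a' = U a b u v * (V a b u v)^2 / (W a b u v)^2 \<and> b' = (V a b u v)^4 / (W a b u v)^3" for u v
  proof -
    have "to_ac (U a b u v) = U (to_ac a) (to_ac b) (to_ac u) (to_ac v)"
      "to_ac (V a b u v) = V (to_ac a) (to_ac b) (to_ac u) (to_ac v)"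
      "to_ac (W a b u v) = W (to_ac a) (to_ac b) (to_ac u) (to_ac v)"
      by (simp_all add: U_def V_def W_def)
    \<comment> \<open>The linear coefficient is \<open>- V\<close>; the sign disappears because the
      criterion uses only its second and fourth powers.\<close>
    then have "(\<exists>\<xi>. ev \<xi> ?f = 0 \<and> ev \<xi> [:3 * b + a * v, u, 2 * v, 4:] = \<tau>) \<longleftrightarrow>
        ev \<tau> [:W a b u v, - V a b u v, U a b u v, 0, 1:] = 0" for \<tau>
      using cubic_image_of_roots[OF two', of "to_ac a" "to_ac b" "to_ac v" "to_ac u" \<tau>]
      by (simp add: ev_quartic algebra_simps power_numeral_reduce)
    from affine_iff[OF this] show ?thesis by simp
  qed

  have "isomorphic_algebras ?f ?g \<longleftrightarrow> (\<exists>y. transports y)"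
    unfolding transports_def
    by (rule isomorphic_algebras_iff_root_bijection)
      (use D[THEN separable_if_D_nonzero] in \<open>simp_all add: quartic_def\<close>)
  also have "\<dots> \<longleftrightarrow> (\<exists>p. affine [:a, p, 2:]) \<or> (\<exists>u v. affine [:3 * b + a * v, u, 2 * v, 4:])"
  proof
    assume "\<exists>y. transports y"
    then obtain y where y: "transports y" by blast
    \<comment> \<open>Reduction modulo the quartic changes no value at its roots, so degree at most
      3 suffices.\<close>
    have "ev x (y mod ?f) = ev x y" if "x \<in> aroots ?f" for x
    proof -
      have "ev x y = ev x (y div ?f * ?f + y mod ?f)" by (simp only: div_mult_mod_eq)
      also have "\<dots> = ev x (y mod ?f)"
        using that by (simp only: ev_add ev_mult) (simp add: aroots_def)
      finally show ?thesis ..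
    qed
    then have mod: "transports (y mod ?f)"
      using y bij_betw_cong[of "aroots ?f" "\<lambda>x. ev x (y mod ?f)" "\<lambda>x. ev x y"]
      by (simp add: transports_def)
    have "Polynomial.degree (y mod ?f) \<le> 3"
      using degree_mod_less[of ?f y] by (auto simp: quartic_def)
    from poly_as_sum_of_monoms'[OF this]
    obtain y0 y1 y2 y3 where "y mod ?f = [:y0, y1, y2, y3:]"
      by (simp add: numeral_3_eq_3 monom_0 monom_Suc) metis
    with mod have y: "transports [:y0, y1, y2, y3:]" by simp
    consider "y3 \<noteq> 0" | "y3 = 0" "y2 \<noteq> 0" | "y3 = 0" "y2 = 0" by blast
    then show "(\<exists>p. affine [:a, p, 2:]) \<or> (\<exists>u v. affine [:3 * b + a * v, u, 2 * v, 4:])"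
    proof cases
      case 1
      \<comment> \<open>Scaling the leading coefficient to 4 fixes \<open>u\<close> and
        \<open>v\<close>. The power sums of the roots are \<open>-2a\<close> and \<open>-3b\<close>
        in degrees 2 and 3, so \<open>3b + av\<close> is the constant term giving trace
        zero.\<close>
      define \<mu> u v where "\<mu> = y3 / 4" "u = 4 * y1 / y3" "v = 2 * y2 / y3"
      have "[:y0, y1, y2, y3:] = [:y0 - \<mu> * (3 * b + a * v):]
          + Polynomial.smult \<mu> [:3 * b + a * v, u, 2 * v, 4:]"
        using 1 two four by (simp add: \<mu>_u_v_def)
      with y have "affine [:3 * b + a * v, u, 2 * v, 4:]"
        unfolding affine_def by metis
      then show ?thesis by blast
    next
      case 2
      \<comment> \<open>Here the leading coefficient is scaled to 2, and trace zero requires the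
        constant term \<open>a\<close>.\<close>
      define \<mu> p where "\<mu> = y2 / 2" "p = y1 / \<mu>"
      have "[:y0, y1, y2, y3:] = [:y0 - \<mu> * a:] + Polynomial.smult \<mu> [:a, p, 2:]"
        using 2 two by (simp add: \<mu>_p_def)
      with y have "affine [:a, p, 2:]"
        unfolding affine_def by metis
      then show ?thesis by blast
    next
      case 3
      then have "[:y0, y1, y2, y3:] = [:y0:] + Polynomial.smult y1 [:0, 1:]" by simp
      with y have "affine [:0, 1:]"
        unfolding affine_def by metis
      with linear show ?thesis by contradiction
    qed
  qed (auto simp: affine_def)
  finally show ?thesis unfolding quadratic cubic .
qed

end
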